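(* Let $S$ be a semigroup containing at least two elements. Then $S$ is a subdirectly irreducible left legal semigroup satisfying the identity $ab=a^2b$ if and only if $S$ is either a subdirectly irreducible left regular band or a two-element zero semigroup.
   Context: A semigroup is left legal if it satisfies the identity $aba=ab$. A left regular band is a semigroup in which every element is idempotent and which satisfies the identity $aba=ab$. A zero semigroup is a semigroup containing a zero element $0$ such that $ab=0$ for all elements $a,b$. A semigroup $S$ is a subdirect product of semigroups $S_i$ ($i\in I$) if $S$ is isomorphic to a subsemigroup $T$ of the direct product of the $S_i$ such that the restrictions to $T$ of all the projection homomorphisms are surjective. A semigroup $S$ is subdirectly irreducible if, whenever $S$ is written as a subdirect product of a family of semigroups $S_i$ ($i\in I$), for at least one $j\in I$ the projection homomorphism $\pi_j$ maps $S$ onto $S_j$ isomorphically. *)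

theory Defs
  imports "HOL-Algebra.Product_Groups"
begin

text \<open>
  Semigroups are carried by the record type \<^typ>\<open>'a monoid\<close>, so that \<^const>\<open>hom\<close>, \<^const>\<open>iso\<close> and
  \<^const>\<open>product_group\<close> (which is the componentwise direct product for any multiplication) can be
  reused. The field \<^const>\<open>one\<close> is arbitrary and never constrained.
\<close>

definition is_semigroup :: "'a monoid \<Rightarrow> bool" where
  "is_semigroup S \<longleftrightarrow>
     carrier S \<noteq> {} \<and>
     (\<forall>a\<in>carrier S. \<forall>b\<in>carrier S. a \<otimes>\<^bsub>S\<^esub> b \<in> carrier S) \<and>
     (\<forall>a\<in>carrier S. \<forall>b\<in>carrier S. \<forall>c\<in>carrier S. (a \<otimes>\<^bsub>S\<^esub> b) \<otimes>\<^bsub>S\<^esub> c = a \<otimes>\<^bsub>S\<^esub> (b \<otimes>\<^bsub>S\<^esub> c))"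

definition is_subsemigroup :: "'a set \<Rightarrow> 'a monoid \<Rightarrow> bool" where
  "is_subsemigroup T S \<longleftrightarrow>
     T \<noteq> {} \<and> T \<subseteq> carrier S \<and> (\<forall>a\<in>T. \<forall>b\<in>T. a \<otimes>\<^bsub>S\<^esub> b \<in> T)"

definition left_legal :: "'a monoid \<Rightarrow> bool" where
  "left_legal S \<longleftrightarrow> is_semigroup S \<and>
     (\<forall>a\<in>carrier S. \<forall>b\<in>carrier S. (a \<otimes>\<^bsub>S\<^esub> b) \<otimes>\<^bsub>S\<^esub> a = a \<otimes>\<^bsub>S\<^esub> b)"

definition left_regular_band :: "'a monoid \<Rightarrow> bool" where
  "left_regular_band S \<longleftrightarrow> is_semigroup S \<and>
     (\<forall>a\<in>carrier S. a \<otimes>\<^bsub>S\<^esub> a = a) \<and>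
     (\<forall>a\<in>carrier S. \<forall>b\<in>carrier S. (a \<otimes>\<^bsub>S\<^esub> b) \<otimes>\<^bsub>S\<^esub> a = a \<otimes>\<^bsub>S\<^esub> b)"

definition is_zero :: "'a monoid \<Rightarrow> 'a \<Rightarrow> bool" where
  "is_zero S z \<longleftrightarrow> z \<in> carrier S \<and> (\<forall>a\<in>carrier S. z \<otimes>\<^bsub>S\<^esub> a = z \<and> a \<otimes>\<^bsub>S\<^esub> z = z)"

definition zero_semigroup :: "'a monoid \<Rightarrow> bool" where
  "zero_semigroup S \<longleftrightarrow> is_semigroup S \<and>
     (\<exists>z. is_zero S z \<and> (\<forall>a\<in>carrier S. \<forall>b\<in>carrier S. a \<otimes>\<^bsub>S\<^esub> b = z))"

text \<open>\<open>\<phi>\<close> is an isomorphism of \<open>S\<close> onto the subdirect subsemigroup \<open>T\<close> of the product of the \<open>F i\<close>.\<close>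

definition subdirect_representation ::
    "'a monoid \<Rightarrow> 'i set \<Rightarrow> ('i \<Rightarrow> 'b monoid) \<Rightarrow> ('i \<Rightarrow> 'b) set \<Rightarrow> ('a \<Rightarrow> 'i \<Rightarrow> 'b) \<Rightarrow> bool" where
  "subdirect_representation S I F T \<phi> \<longleftrightarrow>
     (\<forall>i\<in>I. is_semigroup (F i)) \<and>
     is_subsemigroup T (product_group I F) \<and>
     (\<forall>i\<in>I. (\<lambda>x. x i) ` T = carrier (F i)) \<and>
     \<phi> \<in> iso S ((product_group I F)\<lparr>carrier := T\<rparr>)"

text \<open>
  A definition cannot quantify over types, so index sets and factors are taken from fixed types that
  are large enough: up to isomorphism every factor is a quotient of \<open>S\<close>, whose elements are subsets
  of the carrier, and it is determined by a congruence of \<open>S\<close>. The lemma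
  \<open>subdirectly_irreducible_any_type\<close> below shows that nothing is lost.
\<close>

definition subdirectly_irreducible :: "'a monoid \<Rightarrow> bool" where
  "subdirectly_irreducible S \<longleftrightarrow> is_semigroup S \<and>
     (\<forall>(I :: 'a rel set) (F :: 'a rel \<Rightarrow> 'a set monoid) T \<phi>.
        subdirect_representation S I F T \<phi> \<longrightarrow> (\<exists>j\<in>I. (\<lambda>s. \<phi> s j) \<in> iso S (F j)))"

lemma subdirectly_irreducible_any_type:
  fixes S :: "'a monoid" and I :: "'i set" and F :: "'i \<Rightarrow> 'b monoid"
  assumes SI: "subdirectly_irreducible S"
    and rep: "subdirect_representation S I F T \<phi>"
  shows "\<exists>j\<in>I. (\<lambda>s. \<phi> s j) \<in> iso S (F j)"
proof -
  let ?A = "carrier S"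
  have ne: "?A \<noteq> {}"
    and cl: "\<And>a b. a \<in> ?A \<Longrightarrow> b \<in> ?A \<Longrightarrow> a \<otimes>\<^bsub>S\<^esub> b \<in> ?A"
    and assoc: "\<And>a b c. a \<in> ?A \<Longrightarrow> b \<in> ?A \<Longrightarrow> c \<in> ?A \<Longrightarrow>
                  (a \<otimes>\<^bsub>S\<^esub> b) \<otimes>\<^bsub>S\<^esub> c = a \<otimes>\<^bsub>S\<^esub> (b \<otimes>\<^bsub>S\<^esub> c)"
    using SI by (auto simp: subdirectly_irreducible_def is_semigroup_def)
  have img: "\<phi> ` ?A = T" and inj: "inj_on \<phi> ?A"
    and TP: "T \<subseteq> (\<Pi>\<^sub>E i\<in>I. carrier (F i))"
    and surj: "\<And>i. i \<in> I \<Longrightarrow> (\<lambda>x. x i) ` T = carrier (F i)"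
    and mul: "\<And>a b i. a \<in> ?A \<Longrightarrow> b \<in> ?A \<Longrightarrow> i \<in> I \<Longrightarrow> \<phi> (a \<otimes>\<^bsub>S\<^esub> b) i = \<phi> a i \<otimes>\<^bsub>F i\<^esub> \<phi> b i"
    using rep
    by (auto simp: subdirect_representation_def is_subsemigroup_def iso_iff hom_def)
  define K where "K i = {(a, b). a \<in> ?A \<and> b \<in> ?A \<and> \<phi> a i = \<phi> b i}" for i
  define Q where "Q \<theta> = \<lparr>carrier = ?A // \<theta>,
      mult = (\<lambda>X Y. \<theta> `` {(SOME x. x \<in> X) \<otimes>\<^bsub>S\<^esub> (SOME y. y \<in> Y)}), one = undefined\<rparr>" for \<theta>
  define \<psi> where "\<psi> a = (\<lambda>\<theta>\<in>K ` I. \<theta> `` {a})" for a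
  have eq: "equiv ?A (K i)" for i
    by (rule equivI) (auto simp: K_def refl_on_def sym_def trans_def)
  have cls: "K i `` {a} = K i `` {b} \<longleftrightarrow> \<phi> a i = \<phi> b i" if "a \<in> ?A" "b \<in> ?A" for i a b
    using eq_equiv_class_iff[OF eq that] that by (simp add: K_def)
  have Qmul: "K i `` {a} \<otimes>\<^bsub>Q (K i)\<^esub> K i `` {b} = K i `` {a \<otimes>\<^bsub>S\<^esub> b}"
    if "i \<in> I" "a \<in> ?A" "b \<in> ?A" for i a b
  proof -
    define x where "x = (SOME x. x \<in> K i `` {a})"
    define y where "y = (SOME x. x \<in> K i `` {b})"
    have "x \<in> K i `` {a}" "y \<in> K i `` {b}"
      unfolding x_def y_def
      using someI[of "\<lambda>x. x \<in> K i `` {a}", OF equiv_class_self[OF eq that(2)]]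
        someI[of "\<lambda>x. x \<in> K i `` {b}", OF equiv_class_self[OF eq that(3)]] by auto
    then have "x \<in> ?A" "y \<in> ?A" "\<phi> x i = \<phi> a i" "\<phi> y i = \<phi> b i"
      by (auto simp: K_def)
    then have "K i `` {x \<otimes>\<^bsub>S\<^esub> y} = K i `` {a \<otimes>\<^bsub>S\<^esub> b}"
      using that by (simp add: cls cl mul)
    then show ?thesis
      by (simp add: Q_def x_def y_def)
  qed
  have Qcar: "carrier (Q (K i)) = (\<lambda>a. K i `` {a}) ` ?A" for i
    by (auto simp: Q_def quotient_def)
  have Qsg: "is_semigroup (Q (K i))" if "i \<in> I" for i
    using that ne by (auto simp: is_semigroup_def Qcar Qmul cl assoc)
  have Qhom: "\<psi> (a \<otimes>\<^bsub>S\<^esub> b) = \<psi> a \<otimes>\<^bsub>product_group (K ` I) Q\<^esub> \<psi> b"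
    if "a \<in> ?A" "b \<in> ?A" for a b
    using that by (auto simp: \<psi>_def Qmul intro!: restrict_ext)
  have \<psi>car: "\<psi> a \<in> carrier (product_group (K ` I) Q)" if "a \<in> ?A" for a
    using that by (auto simp: \<psi>_def Qcar)
  have \<psi>inj: "inj_on \<psi> ?A"
  proof (rule inj_onI)
    fix a b assume ab: "a \<in> ?A" "b \<in> ?A" "\<psi> a = \<psi> b"
    have "\<phi> a i = \<phi> b i" if "i \<in> I" for i
      using fun_cong[OF ab(3), of "K i"] that ab by (simp add: \<psi>_def cls)
    moreover have "\<phi> a \<in> (\<Pi>\<^sub>E i\<in>I. carrier (F i))" "\<phi> b \<in> (\<Pi>\<^sub>E i\<in>I. carrier (F i))"
      using ab img TP by auto
    ultimately have "\<phi> a = \<phi> b"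
      by (blast intro: PiE_ext)
    then show "a = b"
      using inj ab by (simp add: inj_on_def)
  qed
  have "subdirect_representation S (K ` I) Q (\<psi> ` ?A) \<psi>"
    unfolding subdirect_representation_def
  proof (intro conjI ballI)
    show "is_semigroup (Q \<theta>)" if "\<theta> \<in> K ` I" for \<theta>
      using that Qsg by auto
    show "is_subsemigroup (\<psi> ` ?A) (product_group (K ` I) Q)"
      unfolding is_subsemigroup_def using ne \<psi>car
      by (auto simp flip: Qhom simp del: mult_product_group carrier_product_group intro!: imageI cl)
    show "(\<lambda>x. x \<theta>) ` \<psi> ` ?A = carrier (Q \<theta>)" if "\<theta> \<in> K ` I" for \<theta>
      using that by (auto simp: \<psi>_def Qcar image_image)
    show "\<psi> \<in> iso S (product_group (K ` I) Q\<lparr>carrier := \<psi> ` ?A\<rparr>)"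
      using \<psi>inj by (auto simp: iso_iff hom_def Qhom simp del: mult_product_group)
  qed
  then obtain \<theta> where "\<theta> \<in> K ` I" "(\<lambda>s. \<psi> s \<theta>) \<in> iso S (Q \<theta>)"
    using SI unfolding subdirectly_irreducible_def by blast
  then obtain j where j: "j \<in> I" "inj_on (\<lambda>s. \<psi> s (K j)) ?A"
    by (auto simp: iso_iff)
  have "inj_on (\<lambda>s. \<phi> s j) ?A"
    using j by (auto simp: inj_on_def \<psi>_def cls)
  moreover have "(\<lambda>s. \<phi> s j) ` ?A = carrier (F j)"
    using surj[OF j(1)] by (simp add: image_image flip: img)
  ultimately have "(\<lambda>s. \<phi> s j) \<in> iso S (F j)"
    using mul j(1) by (auto simp: iso_iff hom_def)
  then show ?thesis
    using j(1) by blast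
qed

end

theory Submission
  imports Defs
begin

text \<open>
  The identities \<open>aba = ab\<close> and \<open>ab = a\<^sup>2b\<close> imply \<open>ab = abb\<close>: indeed
  \<open>ab = (ab)a = (ab)(ab)a = (aba)ba = abba = abb\<close>. Hence all products are idempotent and squaring is
  an endomorphism. Its kernel meets the Rees congruence of the ideal \<open>E\<close> of idempotents in the
  equality relation, so in a subdirectly irreducible semigroup one of them is trivial. If the kernel
  is trivial, then \<open>a\<close> and \<open>a\<^sup>2\<close>, which have the same square, coincide, and \<open>S\<close> is a band. If the Rees
  congruence is trivial, then \<open>E\<close> is a singleton and \<open>S\<close> is a zero semigroup. In a zero semigroup
  every equivalence relation is a congruence, so two distinct nonzero elements would give two
  nontrivial congruences with trivial intersection, each identifying one of them with zero.
\<close>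

lemma is_semigroup_hom_image:
  assumes S: "is_semigroup S" and f: "f \<in> hom S A"
  shows "is_semigroup (A\<lparr>carrier := f ` carrier S\<rparr>)"
proof -
  have mul: "f a \<otimes>\<^bsub>A\<^esub> f b = f (a \<otimes>\<^bsub>S\<^esub> b)" if "a \<in> carrier S" "b \<in> carrier S" for a b
    using f that by (simp add: hom_mult)
  show ?thesis
    using S by (auto simp: is_semigroup_def mul)
qed

text \<open>Together \<open>f\<close> and \<open>g\<close> embed \<open>S\<close> into the product
  of their images, and one projection must be injective. This replaces the argument with two
  congruences meeting in equality: the kernels of \<open>f\<close> and \<open>g\<close> play their
  role, so no quotients have to be built.\<close>

lemma subdirectly_irreducible_hom_pair:
  fixes S :: "'a monoid" and A B :: "'b monoid"
  assumes SI: "subdirectly_irreducible S"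
    and f: "f \<in> hom S A" and g: "g \<in> hom S B"
    and sep: "\<And>a b. a \<in> carrier S \<Longrightarrow> b \<in> carrier S \<Longrightarrow> f a = f b \<Longrightarrow> g a = g b \<Longrightarrow> a = b"
  shows "inj_on f (carrier S) \<or> inj_on g (carrier S)"
proof -
  have S: "is_semigroup S"
    using SI by (simp add: subdirectly_irreducible_def)
  \<comment> \<open>The factors are cut down to the images, which makes the projections surjective
    and inherits associativity from \<open>S\<close>.\<close>
  define F where "F i = (if i then A\<lparr>carrier := f ` carrier S\<rparr> else B\<lparr>carrier := g ` carrier S\<rparr>)" for i
  define \<phi> where "\<phi> a = (\<lambda>i. if i then f a else g a)" for a
  have mul: "\<phi> (a \<otimes>\<^bsub>S\<^esub> b) = \<phi> a \<otimes>\<^bsub>product_group UNIV F\<^esub> \<phi> b"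
    if "a \<in> carrier S" "b \<in> carrier S" for a b
    using that f g by (auto simp: \<phi>_def F_def hom_mult)
  have car: "\<phi> a \<in> carrier (product_group UNIV F)" if "a \<in> carrier S" for a
    using that by (auto simp: \<phi>_def F_def)
  have "subdirect_representation S UNIV F (\<phi> ` carrier S) \<phi>"
    unfolding subdirect_representation_def
  proof (intro conjI ballI)
    show "is_semigroup (F i)" for i
      using is_semigroup_hom_image[OF S f] is_semigroup_hom_image[OF S g] by (simp add: F_def)
    show "is_subsemigroup (\<phi> ` carrier S) (product_group UNIV F)"
      using S car unfolding is_subsemigroup_def is_semigroup_def
      by (auto simp flip: mul simp del: mult_product_group carrier_product_group)
    show "(\<lambda>x. x i) ` \<phi> ` carrier S = carrier (F i)" for i
      by (auto simp: \<phi>_def F_def image_image)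
    have "inj_on \<phi> (carrier S)"
    proof (rule inj_onI)
      fix a b assume ab: "a \<in> carrier S" "b \<in> carrier S" "\<phi> a = \<phi> b"
      show "a = b"
        using ab(1,2) fun_cong[OF ab(3), of True] fun_cong[OF ab(3), of False]
        by (simp add: \<phi>_def sep)
    qed
    then show "\<phi> \<in> iso S (product_group UNIV F\<lparr>carrier := \<phi> ` carrier S\<rparr>)"
      by (auto simp: iso_iff hom_def mul simp del: mult_product_group)
  qed
  \<comment> \<open>The index type \<open>bool\<close> and the factor type are not those fixed in
    the definition, hence the type-independent form.\<close>
  then obtain j where "(\<lambda>s. \<phi> s j) \<in> iso S (F j)"
    using subdirectly_irreducible_any_type[OF SI] by blast
  then show ?thesis
    by (cases j) (auto simp: iso_iff \<phi>_def)
qed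

text \<open>Some coordinate separates the two elements, and on a two-element carrier this already
  makes that projection injective.\<close>

lemma subdirectly_irreducible_card_2:
  assumes S: "is_semigroup S" and card: "card (carrier S) = 2"
  shows "subdirectly_irreducible S"
  unfolding subdirectly_irreducible_def
proof (intro conjI S allI impI)
  fix I :: "'a rel set" and F :: "'a rel \<Rightarrow> 'a set monoid" and T \<phi>
  assume rep: "subdirect_representation S I F T \<phi>"
  obtain x y where xy: "carrier S = {x, y}" "x \<noteq> y"
    using card by (auto simp: card_2_iff)
  have img: "\<phi> ` carrier S = T" and inj: "inj_on \<phi> (carrier S)"
    and TP: "T \<subseteq> (\<Pi>\<^sub>E i\<in>I. carrier (F i))"
    and surj: "\<And>i. i \<in> I \<Longrightarrow> (\<lambda>x. x i) ` T = carrier (F i)"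
    and mul: "\<And>a b i. a \<in> carrier S \<Longrightarrow> b \<in> carrier S \<Longrightarrow> i \<in> I \<Longrightarrow>
                \<phi> (a \<otimes>\<^bsub>S\<^esub> b) i = \<phi> a i \<otimes>\<^bsub>F i\<^esub> \<phi> b i"
    using rep by (auto simp: subdirect_representation_def is_subsemigroup_def iso_iff hom_def)
  have "\<phi> x \<noteq> \<phi> y"
    using inj xy by auto
  moreover have "\<phi> x \<in> (\<Pi>\<^sub>E i\<in>I. carrier (F i))" "\<phi> y \<in> (\<Pi>\<^sub>E i\<in>I. carrier (F i))"
    using img TP xy by auto
  ultimately obtain j where j: "j \<in> I" "\<phi> x j \<noteq> \<phi> y j"
    by (blast intro: PiE_ext)
  have "inj_on (\<lambda>s. \<phi> s j) (carrier S)"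
    using j xy by auto
  moreover have "(\<lambda>s. \<phi> s j) ` carrier S = carrier (F j)"
    using surj[OF j(1)] by (simp add: image_image flip: img)
  ultimately have "(\<lambda>s. \<phi> s j) \<in> iso S (F j)"
    using mul j(1) by (auto simp: iso_iff hom_def)
  then show "\<exists>j\<in>I. (\<lambda>s. \<phi> s j) \<in> iso S (F j)"
    using j(1) by blast
qed

lemma subdirectly_irreducible_zero_semigroup_card:
  assumes SI: "subdirectly_irreducible S" and Z: "zero_semigroup S"
    and nontriv: "\<exists>x\<in>carrier S. \<exists>y\<in>carrier S. x \<noteq> y"
  shows "card (carrier S) = 2"
proof -
  obtain z where z: "z \<in> carrier S"
    and zm: "\<And>a b. a \<in> carrier S \<Longrightarrow> b \<in> carrier S \<Longrightarrow> a \<otimes>\<^bsub>S\<^esub> b = z"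
    using Z by (auto simp: zero_semigroup_def is_zero_def)
  \<comment> \<open>The map \<open>k a\<close> merges \<open>a\<close> with \<open>z\<close> and
    nothing else. It fixes \<open>z\<close>, the value of every product, so it is an
    endomorphism.\<close>
  define k where "k a = (\<lambda>s. if s = a then z else s)" for a
  have hom: "k a \<in> hom S S" for a
    using z by (auto simp: hom_def k_def zm)
  have not_inj: "\<not> inj_on (k a) (carrier S)" if "a \<in> carrier S" "a \<noteq> z" for a
    using that z by (auto simp: inj_on_def k_def)
  have unique: "a = b" if "a \<in> carrier S" "b \<in> carrier S" "a \<noteq> z" "b \<noteq> z" for a b
  proof (rule ccontr)
    assume "a \<noteq> b"
    then have "inj_on (k a) (carrier S) \<or> inj_on (k b) (carrier S)"
      using that by (intro subdirectly_irreducible_hom_pair[OF SI hom hom])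
        (auto simp: k_def split: if_splits)
    then show False
      using not_inj that by blast
  qed
  obtain a where a: "a \<in> carrier S" "a \<noteq> z"
    using nontriv by metis
  have "carrier S = {z, a}"
    using a z unique by blast
  then show ?thesis
    using a by simp
qed

lemma subdirectly_irreducible_left_legal_cases:
  assumes SI: "subdirectly_irreducible S" and LL: "left_legal S"
    and sq: "\<And>a b. a \<in> carrier S \<Longrightarrow> b \<in> carrier S \<Longrightarrow> a \<otimes>\<^bsub>S\<^esub> b = (a \<otimes>\<^bsub>S\<^esub> a) \<otimes>\<^bsub>S\<^esub> b"
  shows "left_regular_band S \<or> zero_semigroup S"
proof -
  have S: "is_semigroup S"
    using LL by (simp add: left_legal_def)
  then have cl: "a \<otimes>\<^bsub>S\<^esub> b \<in> carrier S" if "a \<in> carrier S" "b \<in> carrier S" for a b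
    using that by (simp add: is_semigroup_def)
  have assoc: "(a \<otimes>\<^bsub>S\<^esub> b) \<otimes>\<^bsub>S\<^esub> c = a \<otimes>\<^bsub>S\<^esub> (b \<otimes>\<^bsub>S\<^esub> c)"
    if "a \<in> carrier S" "b \<in> carrier S" "c \<in> carrier S" for a b c
    using that S by (simp add: is_semigroup_def)
  have ll: "(a \<otimes>\<^bsub>S\<^esub> b) \<otimes>\<^bsub>S\<^esub> a = a \<otimes>\<^bsub>S\<^esub> b" if "a \<in> carrier S" "b \<in> carrier S" for a b
    using that LL by (simp add: left_legal_def)
  \<comment> \<open>Regroup as \<open>((ab)a)b\<close> and contract \<open>(ab)a\<close> by left
    legality.\<close>
  have prod_sq: "(a \<otimes>\<^bsub>S\<^esub> b) \<otimes>\<^bsub>S\<^esub> (a \<otimes>\<^bsub>S\<^esub> b) = (a \<otimes>\<^bsub>S\<^esub> b) \<otimes>\<^bsub>S\<^esub> b"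
    if "a \<in> carrier S" "b \<in> carrier S" for a b
    using that by (metis assoc cl ll)
  have abb: "(a \<otimes>\<^bsub>S\<^esub> b) \<otimes>\<^bsub>S\<^esub> b = a \<otimes>\<^bsub>S\<^esub> b" if ab: "a \<in> carrier S" "b \<in> carrier S" for a b
  proof -
    have "a \<otimes>\<^bsub>S\<^esub> b = (a \<otimes>\<^bsub>S\<^esub> b) \<otimes>\<^bsub>S\<^esub> a"
      using ab by (simp add: ll)
    \<comment> \<open>The identity \<open>ab = aab\<close> is applied with \<open>ab\<close> in
      place of \<open>a\<close> and \<open>a\<close> in place of \<open>b\<close>.\<close>
    also have "\<dots> = ((a \<otimes>\<^bsub>S\<^esub> b) \<otimes>\<^bsub>S\<^esub> (a \<otimes>\<^bsub>S\<^esub> b)) \<otimes>\<^bsub>S\<^esub> a"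
      using ab by (intro sq cl)
    also have "\<dots> = (a \<otimes>\<^bsub>S\<^esub> (b \<otimes>\<^bsub>S\<^esub> b)) \<otimes>\<^bsub>S\<^esub> a"
      using ab by (simp add: prod_sq assoc)
    also have "\<dots> = a \<otimes>\<^bsub>S\<^esub> (b \<otimes>\<^bsub>S\<^esub> b)"
      using ab by (intro ll cl)
    finally show ?thesis
      using ab by (metis assoc)
  qed
  have idem: "(a \<otimes>\<^bsub>S\<^esub> b) \<otimes>\<^bsub>S\<^esub> (a \<otimes>\<^bsub>S\<^esub> b) = a \<otimes>\<^bsub>S\<^esub> b" if "a \<in> carrier S" "b \<in> carrier S" for a b
    using that by (simp add: prod_sq abb)
  define E where "E = {a \<in> carrier S. a \<otimes>\<^bsub>S\<^esub> a = a}"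
  have prodE: "a \<otimes>\<^bsub>S\<^esub> b \<in> E" if "a \<in> carrier S" "b \<in> carrier S" for a b
    using that by (simp add: E_def idem cl)
  obtain e where e: "e \<in> E"
    using S prodE by (auto simp: is_semigroup_def)
  define f where "f a = a \<otimes>\<^bsub>S\<^esub> a" for a
  \<comment> \<open>The kernel of \<open>g\<close> is the Rees congruence of \<open>E\<close>. All
    products lie in \<open>E\<close>, so \<open>g\<close> sends them to \<open>e\<close>; the
    constant multiplication of \<open>R\<close> therefore makes \<open>g\<close> a
    homomorphism.\<close>
  define g where "g a = (if a \<in> E then e else a)" for a
  define R where "R = S\<lparr>mult := \<lambda>_ _. e\<rparr>"
  have f_hom: "f \<in> hom S S"
  proof (rule homI)
    fix a b assume ab: "a \<in> carrier S" "b \<in> carrier S"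
    \<comment> \<open>With \<open>abb = ab\<close> this gives \<open>aabb = abb = ab\<close>, which
      equals \<open>(ab)(ab)\<close> by idempotence of products.\<close>
    then have "(a \<otimes>\<^bsub>S\<^esub> a) \<otimes>\<^bsub>S\<^esub> (b \<otimes>\<^bsub>S\<^esub> b) = a \<otimes>\<^bsub>S\<^esub> (b \<otimes>\<^bsub>S\<^esub> b)"
      using sq[of a "b \<otimes>\<^bsub>S\<^esub> b"] cl by simp
    then show "f (a \<otimes>\<^bsub>S\<^esub> b) = f a \<otimes>\<^bsub>S\<^esub> f b"
      using ab abb[of a b] by (simp add: f_def idem assoc)
  qed (simp add: f_def cl)
  have g_hom: "g \<in> hom S R"
    using e by (auto simp: hom_def g_def R_def prodE) (auto simp: E_def)
  have "inj_on f (carrier S) \<or> inj_on g (carrier S)"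
  proof (rule subdirectly_irreducible_hom_pair[OF SI f_hom g_hom])
    \<comment> \<open>On \<open>E\<close> squaring is the identity, so \<open>f\<close> separates
      idempotents. Outside \<open>E\<close> the map \<open>g\<close> is the identity, and its value
      there is never \<open>e\<close>, since \<open>e\<close> lies in \<open>E\<close>.\<close>
    show "a = b" if "a \<in> carrier S" "b \<in> carrier S" "f a = f b" "g a = g b" for a b
      using that e by (auto simp: f_def g_def E_def split: if_splits)
  qed
  then show ?thesis
  proof
    assume inj: "inj_on f (carrier S)"
    have "a \<otimes>\<^bsub>S\<^esub> a = a" if "a \<in> carrier S" for a
      using inj_onD[OF inj, of "a \<otimes>\<^bsub>S\<^esub> a" a] that by (simp add: f_def idem cl)
    then show ?thesis
      using S ll by (simp add: left_regular_band_def)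
  next
    assume inj: "inj_on g (carrier S)"
    have "a = e" if "a \<in> E" for a
      using inj_onD[OF inj, of a e] that e by (simp add: g_def E_def)
    then have "a \<otimes>\<^bsub>S\<^esub> b = e" if "a \<in> carrier S" "b \<in> carrier S" for a b
      using prodE that by blast
    then show ?thesis
      using S e by (auto simp: zero_semigroup_def is_zero_def E_def)
  qed
qed

theorem theorem5:
  fixes S :: "'a monoid"
  assumes "is_semigroup S"
    and "\<exists>x\<in>carrier S. \<exists>y\<in>carrier S. x \<noteq> y"
  shows "(subdirectly_irreducible S \<and> left_legal S \<and>
            (\<forall>a\<in>carrier S. \<forall>b\<in>carrier S. a \<otimes>\<^bsub>S\<^esub> b = (a \<otimes>\<^bsub>S\<^esub> a) \<otimes>\<^bsub>S\<^esub> b))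
         \<longleftrightarrow>
         ((subdirectly_irreducible S \<and> left_regular_band S) \<or>
          (zero_semigroup S \<and> card (carrier S) = 2))"
    (is "?L \<longleftrightarrow> ?R")
proof
  assume ?L
  then show ?R
    using subdirectly_irreducible_left_legal_cases[of S]
      subdirectly_irreducible_zero_semigroup_card[OF _ _ assms(2)] by blast
next
  assume ?R
  then show ?L
  proof (elim disjE conjE)
    assume "subdirectly_irreducible S" "left_regular_band S"
    then show ?L
      by (simp add: left_regular_band_def left_legal_def)
  next
    assume Z: "zero_semigroup S" and card: "card (carrier S) = 2"
    obtain z where "is_zero S z"
      and "\<And>a b. a \<in> carrier S \<Longrightarrow> b \<in> carrier S \<Longrightarrow> a \<otimes>\<^bsub>S\<^esub> b = z"
      using Z by (auto simp: zero_semigroup_def)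
    then show ?L
      using subdirectly_irreducible_card_2[OF assms(1) card] assms(1)
      by (simp add: left_legal_def is_zero_def)
  qed
qed

end
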